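(* Let $\alpha=1/2$, let $c,k_1,k_2>0$ be real, and let $c_1=c_2=c$. The unique equilibrium with positive coordinates of the map $F$ (defined in the context) is $(3c,3c)$, and it is locally stable if $$c^2>\frac{2k_1+2k_2+\sqrt{4k_1^2-7k_1k_2+4k_2^2}}{216}.$$ The system may undergo a period-doubling bifurcation (in the sense fixed in the context) when $$c^2=\frac{2k_1+2k_2+\sqrt{4k_1^2-7k_1k_2+4k_2^2}}{216}.$$ Furthermore, there exist no other bifurcations of the equilibrium: for no values $c,k_1,k_2>0$ does the equilibrium lose its stability through a fold or a Neimark-Sacker bifurcation (in the sense fixed in the context).
   Context: For $\alpha=1/2$ (so $\beta=\alpha/(1-\alpha)=1$) the dynamic Bertrand duopoly game is the iteration $(p_1(t+1),p_2(t+1))=F(p_1(t),p_2(t))$ with $$F(p_1,p_2)=\left(p_1+k_1\frac{-p_2p_1^2+(p_2^2+2p_1p_2)c_1}{p_1^2(p_1+p_2)^2},\;\; p_2+k_2\frac{-p_1p_2^2+(p_1^2+2p_1p_2)c_2}{p_2^2(p_1+p_2)^2}\right),\qquad p_1,p_2>0,$$ where $c_i>0$ are marginal costs and $k_i>0$ are adjustment speeds. An equilibrium is a fixed point of $F$. Let $J$ be the Jacobian matrix of $F$ at the equilibrium and set $$CD_1=1-\mathrm{Tr}(J)+\mathrm{Det}(J),\quad CD_2=1+\mathrm{Tr}(J)+\mathrm{Det}(J),\quad CD_3=1-\mathrm{Det}(J).$$ The equilibrium is called locally stable when both eigenvalues of $J$ have modulus $<1$, equivalently (Jury criterion) when $CD_1>0$,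 $CD_2>0$ and $CD_3>0$; it is then locally asymptotically stable. Bifurcation convention: the system may undergo a fold, period-doubling, or Neimark-Sacker bifurcation when the equilibrium loses its stability at $CD_1=0$, $CD_2=0$, or $CD_3=0$, respectively. Concretely, "may undergo a bifurcation of the given type" at a parameter value means that the corresponding $CD_i$ vanishes there while the other two $CD_j$ are positive; "no loss of stability through a bifurcation of the given type" means that there is no parameter value at which the corresponding $CD_i$ vanishes while the other two $CD_j$ are nonnegative. *)

theory Defs
  imports "HOL-Analysis.Analysis"
begin

text \<open>
  The Bertrand duopoly map for \<open>\<alpha> = 1/2\<close>, with marginal costs \<open>c\<^sub>1, c\<^sub>2\<close> and adjustment speeds
  \<open>k\<^sub>1, k\<^sub>2\<close>. It is meaningful only at strictly positive prices; elsewhere the values are an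
  artefact of totality.
\<close>

definition bertrand :: "real \<Rightarrow> real \<Rightarrow> real \<Rightarrow> real \<Rightarrow> real^2 \<Rightarrow> real^2" where
  "bertrand c\<^sub>1 c\<^sub>2 k\<^sub>1 k\<^sub>2 p = vector
     [p$1 + k\<^sub>1 * ((- p$2 * (p$1)\<^sup>2 + ((p$2)\<^sup>2 + 2 * p$1 * p$2) * c\<^sub>1) / ((p$1)\<^sup>2 * (p$1 + p$2)\<^sup>2)),
      p$2 + k\<^sub>2 * ((- p$1 * (p$2)\<^sup>2 + ((p$1)\<^sup>2 + 2 * p$1 * p$2) * c\<^sub>2) / ((p$2)\<^sup>2 * (p$1 + p$2)\<^sup>2))]"

definition positive_equilibrium :: "(real^2 \<Rightarrow> real^2) \<Rightarrow> real^2 \<Rightarrow> bool" where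
  "positive_equilibrium f p \<longleftrightarrow> p$1 > 0 \<and> p$2 > 0 \<and> f p = p"

definition eigenvalue :: "'a::field^'n^'n \<Rightarrow> 'a \<Rightarrow> bool" where
  "eigenvalue A \<mu> \<longleftrightarrow> (\<exists>v. v \<noteq> 0 \<and> A *v v = \<mu> *s v)"

text \<open>
  The Jacobian is mapped into the complex matrices so that non-real eigenvalues are included.
  Differentiability is required explicitly because the library's \<open>jacobian\<close> is an unspecified
  matrix where the map is not differentiable.
\<close>

definition locally_stable :: "(real^2 \<Rightarrow> real^2) \<Rightarrow> real^2 \<Rightarrow> bool" where
  "locally_stable f p \<longleftrightarrow> f differentiable (at p) \<and>
     (\<forall>\<mu>::complex. eigenvalue (map_matrix of_real (jacobian f (at p))) \<mu> \<longrightarrow> norm \<mu> < 1)"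

definition CD1 :: "(real^2 \<Rightarrow> real^2) \<Rightarrow> real^2 \<Rightarrow> real" where
  "CD1 f p = 1 - trace (jacobian f (at p)) + det (jacobian f (at p))"

definition CD2 :: "(real^2 \<Rightarrow> real^2) \<Rightarrow> real^2 \<Rightarrow> real" where
  "CD2 f p = 1 + trace (jacobian f (at p)) + det (jacobian f (at p))"

definition CD3 :: "(real^2 \<Rightarrow> real^2) \<Rightarrow> real^2 \<Rightarrow> real" where
  "CD3 f p = 1 - det (jacobian f (at p))"

definition may_period_doubling :: "(real^2 \<Rightarrow> real^2) \<Rightarrow> real^2 \<Rightarrow> bool" where
  "may_period_doubling f p \<longleftrightarrow> CD2 f p = 0 \<and> CD1 f p > 0 \<and> CD3 f p > 0"

text \<open>
  To exclude a loss of stability, the weak inequalities are used: this is a stronger exclusion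
  than negating the strict form used in \<open>may_period_doubling\<close>.
\<close>

definition loses_stability_by_fold :: "(real^2 \<Rightarrow> real^2) \<Rightarrow> real^2 \<Rightarrow> bool" where
  "loses_stability_by_fold f p \<longleftrightarrow> CD1 f p = 0 \<and> CD2 f p \<ge> 0 \<and> CD3 f p \<ge> 0"

definition loses_stability_by_neimark_sacker :: "(real^2 \<Rightarrow> real^2) \<Rightarrow> real^2 \<Rightarrow> bool" where
  "loses_stability_by_neimark_sacker f p \<longleftrightarrow> CD3 f p = 0 \<and> CD1 f p \<ge> 0 \<and> CD2 f p \<ge> 0"

end

theory Submission
  imports Defs
begin

text \<open>
  With \<open>a = k\<^sub>1 / (108 c\<^sup>2)\<close> and \<open>b = k\<^sub>2 / (108 c\<^sup>2)\<close> the Jacobian at \<open>(3c, 3c)\<close> has rows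
  \<open>(1 - 4a, a)\<close> and \<open>(b, 1 - 4b)\<close>, so \<open>CD1 = 15ab\<close>, \<open>CD2 = 4 - 8(a + b) + 15ab\<close> and
  \<open>CD3 = 4(a + b) - 15ab\<close>. Hence \<open>CD1\<close> is always positive, and \<open>CD3\<close> is positive as soon as
  \<open>a + b \<le> 1\<close> because \<open>15ab \<le> 15(a + b)\<^sup>2/4\<close>. Multiplied by \<open>u\<^sup>2\<close>, where \<open>u = 108c\<^sup>2\<close>, \<open>CD2\<close> becomes
  a quadratic in \<open>u\<close> whose larger root is the threshold of the theorem; beyond it \<open>a + b < 1\<close>.
\<close>

text \<open>The hypotheses say that the polynomial is positive at 1 and at -1. If a root is real,
  the other is \<open>T - x\<close>, and each value is a product of two factors of equal sign. A
  root outside (-1, 1) thus drags the other one past the same end, and their product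
  \<open>D\<close> exceeds 1.\<close>

lemma jury_criterion:
  fixes T D :: real and z :: complex
  assumes root: "z\<^sup>2 - of_real T * z + of_real D = 0"
    and "1 - T + D > 0" "1 + T + D > 0" "D < 1"
  shows "norm z < 1"
proof -
  obtain x y where z: "z = Complex x y"
    by (cases z)
  from root have re: "x\<^sup>2 - y\<^sup>2 - T * x + D = 0" and im: "2 * x * y = T * y"
    by (auto simp: z complex_eq_iff power2_eq_square)
  show ?thesis
  proof (cases "y = 0")
    case True
    with re have D: "D = x * (T - x)"
      by (simp add: algebra_simps power2_eq_square)
    have pos: "(1 - x) * (1 - (T - x)) > 0" "(1 + x) * (1 + (T - x)) > 0"
      using assms(2,3) by (simp_all add: D algebra_simps)
    have "x < 1"
    proof (rule ccontr)
      assume "\<not> x < 1"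
      with pos(1) have "x > 1" "T - x > 1"
        by (auto simp: zero_less_mult_iff)
      then have "x * (T - x) > 1"
        by (simp add: less_1_mult)
      with D \<open>D < 1\<close> show False by simp
    qed
    moreover have "x > -1"
    proof (rule ccontr)
      assume "\<not> x > -1"
      with pos(2) have "- x > 1" "- (T - x) > 1"
        by (auto simp: zero_less_mult_iff)
      then have "(- x) * (- (T - x)) > 1"
        by (rule less_1_mult)
      with D \<open>D < 1\<close> show False by simp
    qed
    ultimately show ?thesis
      by (simp add: z True cmod_def)
  next
    case False
    \<comment> \<open>A non-real root has its conjugate as the second root, so \<open>D\<close> is
      the squared modulus.\<close>
    with im have "T = 2 * x" by simp
    with re have "x\<^sup>2 + y\<^sup>2 = D"
      by (simp add: power2_eq_square algebra_simps)
    with \<open>D < 1\<close> show ?thesis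
      by (simp add: z cmod_def)
  qed
qed

text \<open>Eliminating either coordinate of an eigenvector from the two linear equations leaves the
  characteristic polynomial times the other coordinate, and some coordinate is nonzero.\<close>

lemma eigenvalue_2_char_poly:
  fixes A :: "'a::field^2^2"
  assumes "eigenvalue A \<mu>"
  shows "\<mu>\<^sup>2 - trace A * \<mu> + det A = 0"
proof -
  obtain v where v: "v \<noteq> 0" "A *v v = \<mu> *s v"
    using assms unfolding eigenvalue_def by blast
  have eq: "A$1$1 * v$1 + A$1$2 * v$2 = \<mu> * v$1" "A$2$1 * v$1 + A$2$2 * v$2 = \<mu> * v$2"
    using v(2) by (simp_all add: vec_eq_iff forall_2 matrix_vector_mult_def sum_2)
  let ?q = "\<mu>\<^sup>2 - (A$1$1 + A$2$2) * \<mu> + (A$1$1 * A$2$2 - A$1$2 * A$2$1)"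
  have "?q * v$1 = 0" "?q * v$2 = 0"
    using eq by algebra+
  moreover have "v$1 \<noteq> 0 \<or> v$2 \<noteq> 0"
    using v(1) by (simp add: vec_eq_iff forall_2)
  ultimately have "?q = 0" by auto
  then show ?thesis
    by (simp add: trace_def sum_2 det_2)
qed

lemma locally_stable_2_jury:
  fixes f :: "real^2 \<Rightarrow> real^2"
  assumes "f differentiable (at p)" "CD1 f p > 0" "CD2 f p > 0" "CD3 f p > 0"
  shows "locally_stable f p"
  unfolding locally_stable_def
proof (intro conjI allI impI)
  fix \<mu> :: complex
  assume "eigenvalue (map_matrix of_real (jacobian f (at p))) \<mu>"
  from eigenvalue_2_char_poly[OF this]
  have "\<mu>\<^sup>2 - of_real (trace (jacobian f (at p))) * \<mu> + of_real (det (jacobian f (at p))) = 0"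
    by (simp add: trace_def sum_2 det_2 map_matrix_def)
  then show "norm \<mu> < 1"
    by (rule jury_criterion) (use assms(2-4) in \<open>simp_all add: CD1_def CD2_def CD3_def\<close>)
qed (fact assms(1))

lemma positive_equilibrium_bertrand_iff:
  assumes "c > 0" "k\<^sub>1 > 0" "k\<^sub>2 > 0"
  shows "positive_equilibrium (bertrand c c k\<^sub>1 k\<^sub>2) p \<longleftrightarrow> p = vector [3 * c, 3 * c]"
proof
  assume eq: "positive_equilibrium (bertrand c c k\<^sub>1 k\<^sub>2) p"
  define x y where "x = p$1" and "y = p$2"
  have pos: "x > 0" "y > 0"
    using eq by (simp_all add: positive_equilibrium_def x_def y_def)
  have "bertrand c c k\<^sub>1 k\<^sub>2 p $ 1 = x" "bertrand c c k\<^sub>1 k\<^sub>2 p $ 2 = y"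
    using eq by (simp_all add: positive_equilibrium_def x_def y_def)
  then have "- y * x\<^sup>2 + (y\<^sup>2 + 2 * x * y) * c = 0" "- x * y\<^sup>2 + (x\<^sup>2 + 2 * x * y) * c = 0"
    using pos assms by (auto simp: bertrand_def x_def[symmetric] y_def[symmetric])
  then have "y * ((y + 2 * x) * c - x\<^sup>2) = 0" "x * ((x + 2 * y) * c - y\<^sup>2) = 0"
    by algebra+
  then have xy: "x\<^sup>2 = (y + 2 * x) * c" "y\<^sup>2 = (x + 2 * y) * c"
    using pos by auto
  \<comment> \<open>Difference of the two equilibrium equations.\<close>
  then have "(x - y) * (x + y - c) = 0"
    by algebra
  \<comment> \<open>Otherwise \<open>x < c\<close>, while the first equation turns into
    \<open>x * x = (c + x) * c\<close>.\<close>
  moreover have "x + y \<noteq> c"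
  proof
    assume "x + y = c"
    with xy(1) have "x * x = (c + x) * c"
      by algebra
    moreover have "x * x < (c + x) * c"
      using \<open>x + y = c\<close> pos by (intro mult_strict_mono) auto
    ultimately show False by simp
  qed
  ultimately have "x = y" by simp
  with xy(1) pos have "x = 3 * c"
    by (simp add: power2_eq_square)
  with \<open>x = y\<close> show "p = vector [3 * c, 3 * c]"
    by (simp add: vec_eq_iff forall_2 x_def y_def)
next
  assume "p = vector [3 * c, 3 * c]"
  with assms show "positive_equilibrium (bertrand c c k\<^sub>1 k\<^sub>2) p"
    by (simp add: positive_equilibrium_def bertrand_def vec_eq_iff forall_2 power2_eq_square)
qed

text \<open>The numerator of each adjustment term vanishes at the equilibrium, so only its own
  partial derivatives over the denominator \<open>324 * c^4\<close> survive. These are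
  \<open>-12 * c^2\<close> for the firm's own price and \<open>3 * c^2\<close> for the rival's,
  whence the factors -4 and 1 and the constant 108.\<close>

lemma has_derivative_bertrand:
  fixes c k\<^sub>1 k\<^sub>2 :: real
  assumes "c > 0"
  defines "a \<equiv> k\<^sub>1 / (108 * c\<^sup>2)" and "b \<equiv> k\<^sub>2 / (108 * c\<^sup>2)"
  shows "(bertrand c c k\<^sub>1 k\<^sub>2 has_derivative
           (*v) (vector [vector [1 - 4 * a, a], vector [b, 1 - 4 * b]]))
         (at (vector [3 * c, 3 * c]))"
proof -
  let ?p = "vector [3 * c, 3 * c] :: real^2"
  have nth: "((\<lambda>p::real^2. p $ i) has_derivative (\<lambda>h. h $ i)) (at ?p)" for i
    by (rule bounded_linear.has_derivative[OF bounded_linear_vec_nth has_derivative_ident])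
  note rules = has_derivative_const has_derivative_add has_derivative_mult_right
    has_derivative_divide' has_derivative_diff has_derivative_minus has_derivative_mult
    has_derivative_mult_left has_derivative_power
  have 1: "((\<lambda>p. bertrand c c k\<^sub>1 k\<^sub>2 p $ 1) has_derivative
      (\<lambda>h. (1 - 4 * a) * h$1 + a * h$2)) (at ?p)"
    unfolding bertrand_def vector_2
    \<comment> \<open>The derivative is left open for the rules to build; there remain a nonzero
      denominator and agreement with the stated row.\<close>
    apply (rule has_derivative_eq_rhs)
     apply (rule rules nth)+
     apply (use assms(1) in simp)
    using assms(1) apply (simp add: a_def fun_eq_iff field_simps power2_eq_square)
    done
  have 2: "((\<lambda>p. bertrand c c k\<^sub>1 k\<^sub>2 p $ 2) has_derivative
      (\<lambda>h. b * h$1 + (1 - 4 * b) * h$2)) (at ?p)"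
    unfolding bertrand_def vector_2
    apply (rule has_derivative_eq_rhs)
     apply (rule rules nth)+
     apply (use assms(1) in simp)
    using assms(1) apply (simp add: b_def fun_eq_iff field_simps power2_eq_square)
    done
  let ?J = "vector [vector [1 - 4 * a, a], vector [b, 1 - 4 * b]] :: real^2^2"
  have "\<forall>i. ((\<lambda>p. bertrand c c k\<^sub>1 k\<^sub>2 p $ i) has_derivative (\<lambda>h. (?J *v h) $ i)) (at ?p)"
    unfolding forall_2 using 1 2 by (simp add: matrix_vector_mult_def sum_2)
  then show ?thesis
    by (subst has_derivative_componentwise_within) (auto simp: Basis_vec_def inner_axis)
qed

lemma
  fixes c k\<^sub>1 k\<^sub>2 :: real
  assumes "c > 0"
  defines "a \<equiv> k\<^sub>1 / (108 * c\<^sup>2)" and "b \<equiv> k\<^sub>2 / (108 * c\<^sup>2)"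
  shows bertrand_differentiable: "bertrand c c k\<^sub>1 k\<^sub>2 differentiable (at (vector [3 * c, 3 * c]))"
    and CD1_bertrand: "CD1 (bertrand c c k\<^sub>1 k\<^sub>2) (vector [3 * c, 3 * c]) = 15 * a * b"
    and CD2_bertrand:
      "CD2 (bertrand c c k\<^sub>1 k\<^sub>2) (vector [3 * c, 3 * c]) = 4 - 8 * (a + b) + 15 * a * b"
    and CD3_bertrand:
      "CD3 (bertrand c c k\<^sub>1 k\<^sub>2) (vector [3 * c, 3 * c]) = 4 * (a + b) - 15 * a * b"
proof -
  note der = has_derivative_bertrand[OF \<open>c > 0\<close>, of k\<^sub>1 k\<^sub>2, folded a_def b_def]
  show "bertrand c c k\<^sub>1 k\<^sub>2 differentiable (at (vector [3 * c, 3 * c]))"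
    using der by (rule differentiableI)
  have J: "jacobian (bertrand c c k\<^sub>1 k\<^sub>2) (at (vector [3 * c, 3 * c])) =
      vector [vector [1 - 4 * a, a], vector [b, 1 - 4 * b]]"
    by (simp add: jacobian_def frechet_derivative_at[OF der, symmetric])
  show "CD1 (bertrand c c k\<^sub>1 k\<^sub>2) (vector [3 * c, 3 * c]) = 15 * a * b"
    "CD2 (bertrand c c k\<^sub>1 k\<^sub>2) (vector [3 * c, 3 * c]) = 4 - 8 * (a + b) + 15 * a * b"
    "CD3 (bertrand c c k\<^sub>1 k\<^sub>2) (vector [3 * c, 3 * c]) = 4 * (a + b) - 15 * a * b"
    unfolding CD1_def CD2_def CD3_def J by (simp_all add: trace_def sum_2 det_2 algebra_simps)
qed

lemma CD3_positive:
  fixes a b :: real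
  assumes "a > 0" "b > 0" "a + b \<le> 1"
  shows "15 * a * b < 4 * (a + b)"
proof -
  have "4 * (a * b) \<le> (a + b) * (a + b)"
    using zero_le_square[of "a - b"] by (simp add: algebra_simps)
  also have "\<dots> \<le> a + b"
    using assms by (simp add: mult_left_le)
  finally have "4 * (a * b) \<le> a + b" .
  \<comment> \<open>The bound obtained is \<open>15/4 * (a + b)\<close>, and 15/4 < 4 makes the
    inequality strict.\<close>
  with assms show ?thesis by simp
qed

text \<open>The form equals \<open>15/4 * (k\<^sub>1 - k\<^sub>2)^2 + 1/4 * (k\<^sub>1 +
  k\<^sub>2)^2\<close>.\<close>

lemma discriminant_nonneg:
  fixes k\<^sub>1 k\<^sub>2 :: real
  shows "4 * k\<^sub>1\<^sup>2 - 7 * k\<^sub>1 * k\<^sub>2 + 4 * k\<^sub>2\<^sup>2 \<ge> 0"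
  using zero_le_power2[of "k\<^sub>1 - k\<^sub>2"] zero_le_power2[of "k\<^sub>1 + k\<^sub>2"]
  by (simp add: power2_eq_square algebra_simps)

text \<open>With \<open>u = 108 * c^2\<close>, completing the square turns the left side into
  \<open>(2 * u - 2 * (k\<^sub>1 + k\<^sub>2))^2 - s^2\<close>, a difference of squares.\<close>

lemma CD2_factorization:
  fixes c k\<^sub>1 k\<^sub>2 :: real
  assumes "c > 0"
  defines "a \<equiv> k\<^sub>1 / (108 * c\<^sup>2)" and "b \<equiv> k\<^sub>2 / (108 * c\<^sup>2)"
    and "s \<equiv> sqrt (4 * k\<^sub>1\<^sup>2 - 7 * k\<^sub>1 * k\<^sub>2 + 4 * k\<^sub>2\<^sup>2)"
  shows "(4 - 8 * (a + b) + 15 * a * b) * (108 * c\<^sup>2)\<^sup>2 =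
      (216 * c\<^sup>2 - (2 * k\<^sub>1 + 2 * k\<^sub>2 + s)) * (216 * c\<^sup>2 - (2 * k\<^sub>1 + 2 * k\<^sub>2 - s))"
proof -
  have s: "s\<^sup>2 = 4 * k\<^sub>1\<^sup>2 - 7 * k\<^sub>1 * k\<^sub>2 + 4 * k\<^sub>2\<^sup>2"
    by (simp add: s_def discriminant_nonneg)
  define u where "u = 108 * c\<^sup>2"
  have k: "k\<^sub>1 = a * u" "k\<^sub>2 = b * u"
    using assms(1) by (simp_all add: a_def b_def u_def)
  have "216 * c\<^sup>2 = 2 * u" by (simp add: u_def)
  with s k show ?thesis
    unfolding u_def[symmetric] by algebra
qed

theorem theorem1:
  fixes c k\<^sub>1 k\<^sub>2 :: real
  assumes "c > 0" and "k\<^sub>1 > 0" and "k\<^sub>2 > 0"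
  shows "(\<forall>p. positive_equilibrium (bertrand c c k\<^sub>1 k\<^sub>2) p \<longleftrightarrow> p = vector [3 * c, 3 * c]) \<and>
    (c\<^sup>2 > (2 * k\<^sub>1 + 2 * k\<^sub>2 + sqrt (4 * k\<^sub>1\<^sup>2 - 7 * k\<^sub>1 * k\<^sub>2 + 4 * k\<^sub>2\<^sup>2)) / 216 \<longrightarrow>
       locally_stable (bertrand c c k\<^sub>1 k\<^sub>2) (vector [3 * c, 3 * c])) \<and>
    (c\<^sup>2 = (2 * k\<^sub>1 + 2 * k\<^sub>2 + sqrt (4 * k\<^sub>1\<^sup>2 - 7 * k\<^sub>1 * k\<^sub>2 + 4 * k\<^sub>2\<^sup>2)) / 216 \<longrightarrow>
       may_period_doubling (bertrand c c k\<^sub>1 k\<^sub>2) (vector [3 * c, 3 * c])) \<and>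
    \<not> loses_stability_by_fold (bertrand c c k\<^sub>1 k\<^sub>2) (vector [3 * c, 3 * c]) \<and>
    \<not> loses_stability_by_neimark_sacker (bertrand c c k\<^sub>1 k\<^sub>2) (vector [3 * c, 3 * c])"
proof -
  define a b s where "a = k\<^sub>1 / (108 * c\<^sup>2)" and "b = k\<^sub>2 / (108 * c\<^sup>2)"
    and "s = sqrt (4 * k\<^sub>1\<^sup>2 - 7 * k\<^sub>1 * k\<^sub>2 + 4 * k\<^sub>2\<^sup>2)"
  let ?f = "bertrand c c k\<^sub>1 k\<^sub>2" and ?p = "vector [3 * c, 3 * c] :: real^2"
  note CD = CD1_bertrand[OF \<open>c > 0\<close>, of k\<^sub>1 k\<^sub>2, folded a_def b_def]
    CD2_bertrand[OF \<open>c > 0\<close>, of k\<^sub>1 k\<^sub>2, folded a_def b_def]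
    CD3_bertrand[OF \<open>c > 0\<close>, of k\<^sub>1 k\<^sub>2, folded a_def b_def]
  note fact = CD2_factorization[OF \<open>c > 0\<close>, of k\<^sub>1 k\<^sub>2, folded a_def b_def s_def]
  have pos: "a > 0" "b > 0"
    using assms by (simp_all add: a_def b_def)
  have CD1: "CD1 ?f ?p > 0"
    using pos by (simp add: CD)
  have s: "s \<ge> 0" by (simp add: s_def discriminant_nonneg)
  \<comment> \<open>Dropping \<open>s \<ge> 0\<close> leaves
    \<open>k\<^sub>1 + k\<^sub>2 \<le> 108 * c^2\<close>.\<close>
  have ab: "a + b \<le> 1" if "216 * c\<^sup>2 \<ge> 2 * k\<^sub>1 + 2 * k\<^sub>2 + s"
    using that s assms by (simp add: a_def b_def add_divide_distrib[symmetric])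
  have CD3: "CD3 ?f ?p > 0" if "a + b \<le> 1"
    using CD3_positive[OF pos that] by (simp add: CD)
  have "locally_stable ?f ?p" if "c\<^sup>2 > (2 * k\<^sub>1 + 2 * k\<^sub>2 + s) / 216"
  proof (rule locally_stable_2_jury[OF bertrand_differentiable[OF \<open>c > 0\<close>] CD1])
    from that have gt: "216 * c\<^sup>2 > 2 * k\<^sub>1 + 2 * k\<^sub>2 + s" by simp
    then show "CD3 ?f ?p > 0"
      by (intro CD3 ab) simp
    \<comment> \<open>Beyond the larger root both linear factors are positive.\<close>
    have "(4 - 8 * (a + b) + 15 * a * b) * (108 * c\<^sup>2)\<^sup>2 > 0"
      unfolding fact using gt s by (intro mult_pos_pos) simp_all
    then show "CD2 ?f ?p > 0"
      using \<open>c > 0\<close> by (simp add: CD zero_less_mult_iff)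
  qed
  moreover have "may_period_doubling ?f ?p" if "c\<^sup>2 = (2 * k\<^sub>1 + 2 * k\<^sub>2 + s) / 216"
  proof -
    from that have eq: "216 * c\<^sup>2 = 2 * k\<^sub>1 + 2 * k\<^sub>2 + s" by simp
    then have "(4 - 8 * (a + b) + 15 * a * b) * (108 * c\<^sup>2)\<^sup>2 = 0"
      unfolding fact by simp
    then have "CD2 ?f ?p = 0"
      using \<open>c > 0\<close> unfolding CD by simp
    moreover have "CD3 ?f ?p > 0"
      using eq by (intro CD3 ab) simp
    ultimately show ?thesis
      using CD1 by (simp add: may_period_doubling_def)
  qed
  moreover have "\<not> loses_stability_by_fold ?f ?p"
    using CD1 by (simp add: loses_stability_by_fold_def)
  moreover have "\<not> loses_stability_by_neimark_sacker ?f ?p"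
  proof
    assume "loses_stability_by_neimark_sacker ?f ?p"
    then have 0: "CD3 ?f ?p = 0" and "CD2 ?f ?p \<ge> 0"
      by (simp_all add: loses_stability_by_neimark_sacker_def)
    \<comment> \<open>Where \<open>CD3\<close> vanishes, \<open>15 * a * b = 4 * (a + b)\<close>, so
      \<open>CD2\<close> reduces to \<open>4 - 4 * (a + b)\<close>; its nonnegativity gives the
      bound under which \<open>CD3\<close> is positive.\<close>
    then have "a + b \<le> 1" by (simp add: CD)
    from CD3[OF this] 0 show False by simp
  qed
  ultimately show ?thesis
    using positive_equilibrium_bertrand_iff[OF assms] by (simp add: s_def)
qed

end
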